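(* The binary operation $\circledast$ on $I^{[2]}$ satisfies $$\mathbf{x}\circledast(\mathbf{y}\vee\mathbf{z})=(\mathbf{x}\circledast\mathbf{y})\vee(\mathbf{x}\circledast\mathbf{z})\quad\text{for all }\mathbf{x},\mathbf{y},\mathbf{z}\in I^{[2]}.$$
   Context: $I=[0,1]$ and $I^{[2]}=\{[a,b]:0\le a\le b\le 1\}$ is the set of closed subintervals of $I$ (single points $\{a\}=[a,a]$ included). On $I^{[2]}$, $[x_1,y_1]\vee[x_2,y_2]=[x_1\vee x_2,y_1\vee y_2]$, where $\vee$ on $I$ is maximum. The binary operation $\circledast$ on $I^{[2]}$ is defined by $\mathbf{x}\circledast\mathbf{y}=\max\{x\cdot y: x\in\mathbf{x},\,y\in\mathbf{y}\}$, where the real number on the right is identified with the corresponding one-point interval; i.e. $[x_1,x_2]\circledast[y_1,y_2]=\{x_2y_2\}=[x_2y_2,x_2y_2]$. *)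

theory Defs
  imports "HOL-Library.Interval"
begin

definition unit_intervals :: "real interval set"
  where "unit_intervals = {X. set_of X \<subseteq> {0..1}}"

text \<open>
  The lattice operation \<open>sup\<close> that the library puts on intervals is the convex hull of the union.
  The join needed here is the endpointwise maximum, which is \<^const>\<open>max_interval\<close>.
\<close>

abbreviation ivl_join :: "real interval \<Rightarrow> real interval \<Rightarrow> real interval" (infixl \<open>\<or>\<^sub>I\<close> 65)
  where "X \<or>\<^sub>I Y \<equiv> max_interval X Y"

text \<open>
  The set of products is infinite in general, so its maximum is taken with \<^const>\<open>Greatest\<close>:
  \<^const>\<open>Max\<close> is meaningful for finite sets only.
\<close>

definition ivl_cast :: "real interval \<Rightarrow> real interval \<Rightarrow> real interval" (infixl \<open>\<circledast>\<close> 70)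
  where "X \<circledast> Y = interval_of (GREATEST m. m \<in> {x * y | x y. x \<in> set_of X \<and> y \<in> set_of Y})"

lemma unit_intervals_iff: "X \<in> unit_intervals \<longleftrightarrow> 0 \<le> lower X \<and> upper X \<le> 1"
  by (auto simp: unit_intervals_def set_of_eq)

lemma ivl_join_closed: "X \<in> unit_intervals \<Longrightarrow> Y \<in> unit_intervals \<Longrightarrow> X \<or>\<^sub>I Y \<in> unit_intervals"
  by (auto simp: unit_intervals_iff)

lemma ivl_cast_eq:
  assumes "X \<in> unit_intervals" "Y \<in> unit_intervals"
  shows "X \<circledast> Y = interval_of (upper X * upper Y)"
proof -
  have nonneg: "0 \<le> lower X" "0 \<le> lower Y"
    using assms by (auto simp: unit_intervals_iff)
  have "(GREATEST m. m \<in> {x * y | x y. x \<in> set_of X \<and> y \<in> set_of Y}) = upper X * upper Y"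
  proof (rule Greatest_equality)
    show "upper X * upper Y \<in> {x * y | x y. x \<in> set_of X \<and> y \<in> set_of Y}"
      by (force simp: set_of_eq)
  next
    fix m assume "m \<in> {x * y | x y. x \<in> set_of X \<and> y \<in> set_of Y}"
    then show "m \<le> upper X * upper Y"
      using nonneg by (auto simp: set_of_eq intro!: mult_mono)
  qed
  then show ?thesis
    by (simp add: ivl_cast_def)
qed

lemma ivl_cast_closed:
  assumes "X \<in> unit_intervals" "Y \<in> unit_intervals"
  shows "X \<circledast> Y \<in> unit_intervals"
proof -
  have "0 \<le> upper X" "0 \<le> upper Y" "upper X \<le> 1" "upper Y \<le> 1"
    using assms lower_le_upper[of X] lower_le_upper[of Y]
    by (auto simp: unit_intervals_iff simp del: lower_le_upper)
  then have "0 \<le> upper X * upper Y" "upper X * upper Y \<le> 1"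
    by (auto intro: mult_le_one)
  then show ?thesis
    by (simp add: ivl_cast_eq[OF assms] unit_intervals_iff)
qed

end

theory Submission
  imports Defs
begin

text \<open>
  For intervals in \<open>[0,1]\<close> the largest product is attained at the upper endpoints, so \<open>\<circledast>\<close> only
  sees upper endpoints, and the join acts on these as \<^const>\<open>max\<close>. The law thus reduces to
  multiplication by the nonnegative number \<^term>\<open>upper x\<close> distributing over \<^const>\<open>max\<close>.
\<close>

theorem proposition9:
  fixes x y z :: "real interval"
  assumes "x \<in> unit_intervals" and "y \<in> unit_intervals" and "z \<in> unit_intervals"
  shows "x \<circledast> (y \<or>\<^sub>I z) = (x \<circledast> y) \<or>\<^sub>I (x \<circledast> z)"
proof -
  have "0 \<le> upper x"
    using assms(1) lower_le_upper[of x] by (simp add: unit_intervals_iff del: lower_le_upper)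
  then have "upper x * max (upper y) (upper z) = max (upper x * upper y) (upper x * upper z)"
    by (simp add: max_mult_distrib_left)
  then show ?thesis
    using assms by (simp add: ivl_cast_eq ivl_join_closed interval_eq_iff)
qed

end
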